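(* Let $(X,G)$ be a complete $G$-metric space and let $A,B,S,T:X\to X$ be mappings. Let $\kappa\in[0,\tfrac12)$ be such that for all $x,y\in X$ $$G(Sx,Ty,Ty)\le \kappa\,\bigl(G(Sx,Ax,Ax)+G(Ty,By,By)\bigr),$$ $$G(Sx,Sx,Ty)\le \kappa\,\bigl(G(Sx,Sx,Ax)+G(Ty,Ty,By)\bigr).$$ Assume that: 1) $TX\subseteq AX$ and $SX\subseteq BX$; 2) the mappings $A$ and $B$ are sequentially continuous; 3) the pairs $\{A,S\}$ and $\{B,T\}$ are weakly commuting. Then $A,B,S$ and $T$ have a unique common fixed point, i.e. there is exactly one $z\in X$ with $Az=Bz=Sz=Tz=z$.
   Context: A $G$-metric on a nonempty set $X$ is a function $G:X\times X\times X\to[0,\infty)$ such that: (G1) $G(x,y,z)=0$ if $x=y=z$; (G2) $G(x,y,z)>0$ for all $x,y,z\in X$ with $x\ne y$; (G3) $G(x,x,y)\le G(x,y,z)$ for all $x,y,z\in X$ with $y\neq z$; (G4) $G$ is invariant under all permutations of its three arguments; (G5) $G(x,y,z)\le G(x,a,a)+G(a,y,z)$ for all $x,y,z,a\in X$. The pair $(X,G)$ is then called a $G$-metric space (it is not assumed that $G(x,y,y)=G(y,x,x)$). A sequence $(x_n)$ in $X$ is $G$-Cauchy if for every $\varepsilon>0$ there is $n_0$ with $G(x_n,x_m,x_l)<\varepsilon$ for all $n,m,l\ge n_0$. It is $G$-convergent to $x\in X$ if for every $\varepsilon>0$ there is $n_0$ with $G(x,x_n,x_m)<\varepsilon$ for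 all $n,m\ge n_0$. The space is ($G$-)complete if every $G$-Cauchy sequence is $G$-convergent in $X$. A map $f:X\to X$ is sequentially continuous if $fx_n$ $G$-converges to $fx$ whenever $x_n$ $G$-converges to $x$. Self-maps $f,g$ of $X$ are weakly commuting if $G(fgx,gfx,gfx)\le G(fx,gx,gx)$ for all $x\in X$, where $fgx=f(g(x))$. For the pair $\{A,S\}$ this is taken with $f=S,\ g=A$, i.e. $G(SAx,ASx,ASx)\le G(Sx,Ax,Ax)$ for all $x\in X$; for the pair $\{B,T\}$ with $f=T,\ g=B$, i.e. $G(TBx,BTx,BTx)\le G(Tx,Bx,Bx)$ for all $x\in X$. Notation: $fX=\{fx:x\in X\}$. *)

theory Defs
  imports Complex_Main "HOL-Library.FuncSet"
begin

locale G_metric_space =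
  fixes X :: "'a set" and G :: "'a \<Rightarrow> 'a \<Rightarrow> 'a \<Rightarrow> real"
  assumes nonempty: "X \<noteq> {}"
    and nonneg: "\<lbrakk>x \<in> X; y \<in> X; z \<in> X\<rbrakk> \<Longrightarrow> 0 \<le> G x y z"
    and G1: "\<lbrakk>x \<in> X; y \<in> X; z \<in> X; x = y; y = z\<rbrakk> \<Longrightarrow> G x y z = 0"
    and G2: "\<lbrakk>x \<in> X; y \<in> X; z \<in> X; x \<noteq> y\<rbrakk> \<Longrightarrow> 0 < G x y z"
    and G3: "\<lbrakk>x \<in> X; y \<in> X; z \<in> X; y \<noteq> z\<rbrakk> \<Longrightarrow> G x x y \<le> G x y z"
    and G4: "\<lbrakk>x \<in> X; y \<in> X; z \<in> X\<rbrakk> \<Longrightarrow>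
      G x y z = G x z y \<and> G x y z = G y x z \<and> G x y z = G y z x \<and>
      G x y z = G z x y \<and> G x y z = G z y x"
    and G5: "\<lbrakk>x \<in> X; y \<in> X; z \<in> X; a \<in> X\<rbrakk> \<Longrightarrow> G x y z \<le> G x a a + G a y z"

definition G_Cauchy :: "'a set \<Rightarrow> ('a \<Rightarrow> 'a \<Rightarrow> 'a \<Rightarrow> real) \<Rightarrow> (nat \<Rightarrow> 'a) \<Rightarrow> bool" where
  "G_Cauchy X G s \<longleftrightarrow> (\<forall>n. s n \<in> X) \<and>
    (\<forall>\<epsilon>>0. \<exists>n0. \<forall>n\<ge>n0. \<forall>m\<ge>n0. \<forall>l\<ge>n0. G (s n) (s m) (s l) < \<epsilon>)"

definition G_converges ::
  "'a set \<Rightarrow> ('a \<Rightarrow> 'a \<Rightarrow> 'a \<Rightarrow> real) \<Rightarrow> (nat \<Rightarrow> 'a) \<Rightarrow> 'a \<Rightarrow> bool" where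
  "G_converges X G s x \<longleftrightarrow> (\<forall>n. s n \<in> X) \<and> x \<in> X \<and>
    (\<forall>\<epsilon>>0. \<exists>n0. \<forall>n\<ge>n0. \<forall>m\<ge>n0. G x (s n) (s m) < \<epsilon>)"

definition G_complete :: "'a set \<Rightarrow> ('a \<Rightarrow> 'a \<Rightarrow> 'a \<Rightarrow> real) \<Rightarrow> bool" where
  "G_complete X G \<longleftrightarrow> (\<forall>s. G_Cauchy X G s \<longrightarrow> (\<exists>x\<in>X. G_converges X G s x))"

definition seq_continuous ::
  "'a set \<Rightarrow> ('a \<Rightarrow> 'a \<Rightarrow> 'a \<Rightarrow> real) \<Rightarrow> ('a \<Rightarrow> 'a) \<Rightarrow> bool" where
  "seq_continuous X G f \<longleftrightarrow>
    (\<forall>s x. G_converges X G s x \<longrightarrow> G_converges X G (\<lambda>n. f (s n)) (f x))"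

text \<open>The order of the two maps matters, since \<open>G x y y\<close> and \<open>G y x x\<close> may differ.\<close>

definition weakly_commuting ::
  "'a set \<Rightarrow> ('a \<Rightarrow> 'a \<Rightarrow> 'a \<Rightarrow> real) \<Rightarrow> ('a \<Rightarrow> 'a) \<Rightarrow> ('a \<Rightarrow> 'a) \<Rightarrow> bool" where
  "weakly_commuting X G f g \<longleftrightarrow>
    (\<forall>x\<in>X. G (f (g x)) (g (f x)) (g (f x)) \<le> G (f x) (g x) (g x))"

end

theory Submission
  imports Defs
begin

text \<open>The symmetrization \<open>d x y = G x y y + G y x x\<close> is a metric with the same convergent and
  Cauchy sequences as \<open>G\<close>, and adding the two hypotheses gives the Kannan-type inequality
  \<open>d (S x) (T y) \<le> \<kappa> (d (S x) (A x) + d (T y) (B y))\<close>. The Jungck sequence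
  \<open>S x\<^sub>0 = B x\<^sub>1, T x\<^sub>1 = A x\<^sub>2, S x\<^sub>2 = B x\<^sub>3, \<dots>\<close> is then a Cauchy sequence with
  ratio \<open>\<kappa> / (1 - \<kappa>) < 1\<close>; let \<open>z\<close> be its limit. Weak commutation and continuity make \<open>S A x\<close> and
  \<open>A A x\<close> tend to \<open>A z\<close>, and \<open>T B x\<close> and \<open>B B x\<close> tend to \<open>B z\<close>, along the sequence, and passing
  to the limit in the Kannan inequality identifies successively \<open>A z\<close> with \<open>B z\<close>, \<open>S z\<close>, \<open>T z\<close>
  and \<open>z\<close>.\<close>

context G_metric_space
begin

definition d :: "'a \<Rightarrow> 'a \<Rightarrow> real" where
  "d x y = G x y y + G y x x"

lemma d_nonneg: "\<lbrakk>x \<in> X; y \<in> X\<rbrakk> \<Longrightarrow> 0 \<le> d x y"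
  by (simp add: d_def nonneg)

lemma d_commute: "d x y = d y x"
  by (simp add: d_def)

lemma d_refl: "x \<in> X \<Longrightarrow> d x x = 0"
  by (simp add: d_def G1)

lemma d_le_0_imp_eq: "\<lbrakk>x \<in> X; y \<in> X; d x y \<le> 0\<rbrakk> \<Longrightarrow> x = y"
  using G2[of x y y] nonneg[of y x x] by (force simp: d_def)

lemma d_triangle: "\<lbrakk>x \<in> X; y \<in> X; z \<in> X\<rbrakk> \<Longrightarrow> d x z \<le> d x y + d y z"
  using G5[of x z z y] G5[of z x x y] by (simp add: d_def)

lemma G_le_d: "\<lbrakk>x \<in> X; y \<in> X\<rbrakk> \<Longrightarrow> G x y y \<le> d x y"
  by (simp add: d_def nonneg)

lemma G_swap: "\<lbrakk>x \<in> X; y \<in> X\<rbrakk> \<Longrightarrow> G x x y = G y x x"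
  using G4[of x x y] by blast

text \<open>\<open>G5\<close> through the middle point \<open>y\<close> and symmetry give
  \<open>G y x x \<le> 2 * G x y y\<close>, so a bound on one order of the arguments already
  controls \<open>d\<close>.\<close>

lemma d_le_3_G: "\<lbrakk>x \<in> X; y \<in> X\<rbrakk> \<Longrightarrow> d x y \<le> 3 * G x y y"
  using G5[of x y x y] G4[of x y x] G4[of y y x] by (auto simp: d_def)

lemma G_le_d_add_d: "\<lbrakk>x \<in> X; y \<in> X; z \<in> X\<rbrakk> \<Longrightarrow> G x y z \<le> d x y + d x z"
  using G5[of y x z x] G4[of x y z] G4[of x x z] nonneg[of x y y] nonneg[of x z z]
  by (auto simp: d_def)

text \<open>Transfers \<open>G\<close>-convergence to real limits: \<open>d_le_3_G\<close> on the
  diagonal \<open>n = m\<close> gives one direction, \<open>G_le_d_add_d\<close> the other.\<close>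

lemma G_converges_iff:
  "G_converges X G s x \<longleftrightarrow> range s \<subseteq> X \<and> x \<in> X \<and> (\<lambda>n. d (s n) x) \<longlonglongrightarrow> 0"
proof (cases "range s \<subseteq> X \<and> x \<in> X")
  case True
  then have s: "s n \<in> X" and x: "x \<in> X" for n by auto
  show ?thesis
  proof
    assume conv: "G_converges X G s x"
    have "(\<lambda>n. d (s n) x) \<longlonglongrightarrow> 0"
    proof (rule LIMSEQ_I)
      fix r :: real assume "0 < r"
      then obtain N where N: "G x (s n) (s m) < r / 3" if "n \<ge> N" "m \<ge> N" for n m
        using conv unfolding G_converges_def by (meson divide_pos_pos zero_less_numeral)
      have "norm (d (s n) x - 0) < r" if "n \<ge> N" for n
        using N[OF that that] d_le_3_G[OF x s[of n]] d_nonneg[OF x s[of n]]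
        by (simp add: d_commute[of "s n"])
      then show "\<exists>N. \<forall>n\<ge>N. norm (d (s n) x - 0) < r" by blast
    qed
    then show "range s \<subseteq> X \<and> x \<in> X \<and> (\<lambda>n. d (s n) x) \<longlonglongrightarrow> 0" using True by simp
  next
    assume "range s \<subseteq> X \<and> x \<in> X \<and> (\<lambda>n. d (s n) x) \<longlonglongrightarrow> 0"
    then have lim: "(\<lambda>n. d (s n) x) \<longlonglongrightarrow> 0" by simp
    have "\<exists>N. \<forall>n\<ge>N. \<forall>m\<ge>N. G x (s n) (s m) < r" if r: "0 < r" for r
    proof -
      obtain N where N: "d x (s n) < r / 2" if "n \<ge> N" for n
        using LIMSEQ_D[OF lim, of "r / 2"] r d_commute by (metis abs_less_iff diff_zero half_gt_zero real_norm_def)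
      have "G x (s n) (s m) < r" if "n \<ge> N" "m \<ge> N" for n m
        using N[OF that(1)] N[OF that(2)] G_le_d_add_d[OF x s[of n] s[of m]] by linarith
      then show ?thesis by blast
    qed
    then show "G_converges X G s x" using s x by (simp add: G_converges_def)
  qed
qed (auto simp: G_converges_def)

lemma G_converges_subseq:
  assumes "G_converges X G s x" and "strict_mono (r :: nat \<Rightarrow> nat)"
  shows "G_converges X G (\<lambda>n. s (r n)) x"
  using assms LIMSEQ_subseq_LIMSEQ[of "\<lambda>n. d (s n) x" 0 r]
  by (auto simp: G_converges_iff o_def)

lemma G_converges_const: "x \<in> X \<Longrightarrow> G_converges X G (\<lambda>_. x) x"
  by (auto simp: G_converges_iff d_refl)

lemma tendsto_d:
  assumes "G_converges X G s x" and "G_converges X G t y"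
  shows "(\<lambda>n. d (s n) (t n)) \<longlonglongrightarrow> d x y"
proof -
  have x: "x \<in> X" and y: "y \<in> X" and s: "s n \<in> X" and t: "t n \<in> X" for n
    using assms by (auto simp: G_converges_iff)
  have "(\<lambda>n. d (s n) x + d (t n) y) \<longlonglongrightarrow> 0 + 0"
    using assms by (intro tendsto_add) (auto simp: G_converges_iff)
  then have lim: "(\<lambda>n. d (s n) x + d (t n) y) \<longlonglongrightarrow> 0" by simp
  have "\<bar>d (s n) (t n) - d x y\<bar> \<le> d (s n) x + d (t n) y" for n
    using d_triangle[OF s[of n] x t[of n]] d_triangle[OF x y t[of n]]
      d_triangle[OF x s[of n] y] d_triangle[OF s[of n] t[of n] y]
      d_commute[of x "s n"] d_commute[of y "t n"]
    by linarith
  then have "(\<lambda>n. d (s n) (t n) - d x y) \<longlonglongrightarrow> 0"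
    by (intro tendsto_0_le[OF lim, of _ 1] always_eventually allI)
      (metis abs_ge_self mult.right_neutral order_trans real_norm_def)
  then show ?thesis by (simp add: LIM_zero_iff)
qed

lemma G_Cauchy_if_geometric:
  fixes q :: real
  assumes s: "\<And>n. s n \<in> X" and q: "0 \<le> q" "q < 1"
    and step: "\<And>n. d (s (Suc n)) (s (Suc (Suc n))) \<le> q * d (s n) (s (Suc n))"
  shows "G_Cauchy X G s"
proof -
  \<comment> \<open>\<open>C\<close> bounds the sum of the geometric series of step lengths. The
    telescoping bound in \<open>many\<close> below makes the induction on \<open>k\<close>
    close.\<close>
  define C where "C = d (s 0) (s 1) / (1 - q)"
  have C0: "0 \<le> C" using q d_nonneg[OF s s] by (simp add: C_def)
  have one: "d (s n) (s (Suc n)) \<le> C * (1 - q) * q ^ n" for n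
  proof (induction n)
    case 0
    then show ?case using q by (simp add: C_def)
  next
    case (Suc n)
    have "d (s (Suc n)) (s (Suc (Suc n))) \<le> q * (C * (1 - q) * q ^ n)"
      using step[of n] mult_left_mono[OF Suc q(1)] by linarith
    then show ?case by (simp add: mult_ac)
  qed
  have many: "d (s n) (s (n + k)) \<le> C * q ^ n - C * q ^ (n + k)" for n k
  proof (induction k)
    case 0
    then show ?case by (simp add: d_refl s)
  next
    case (Suc k)
    have "C * q ^ n - C * q ^ (n + k) + C * (1 - q) * q ^ (n + k)
        = C * q ^ n - C * q ^ (n + Suc k)"
      by (simp add: algebra_simps)
    then show ?case
      using d_triangle[OF s[of n] s[of "n + k"] s[of "n + Suc k"]] one[of "n + k"] Suc by simp
  qed
  have near: "d (s N) (s n) \<le> C * q ^ N" if "n \<ge> N" for N n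
  proof -
    have "0 \<le> C * q ^ n" using C0 q by simp
    then show ?thesis using many[of N "n - N"] that by simp
  qed
  have "\<exists>N. \<forall>n\<ge>N. \<forall>m\<ge>N. \<forall>l\<ge>N. G (s n) (s m) (s l) < r" if r: "0 < r" for r
  proof -
    have "(\<lambda>n. C * q ^ n) \<longlonglongrightarrow> C * 0"
      using q by (intro tendsto_mult tendsto_const LIMSEQ_realpow_zero)
    \<comment> \<open>\<open>r / 4\<close> because two distances from \<open>s n\<close>, each
      routed through \<open>s N\<close>, cost four distances to \<open>s N\<close>.\<close>
    then have "\<forall>\<^sub>F n in sequentially. C * q ^ n < r / 4"
      using r by (intro order_tendstoD(2)[of _ 0]) auto
    then obtain N where N: "C * q ^ N < r / 4" by (auto simp: eventually_sequentially)
    have "G (s n) (s m) (s l) < r" if "n \<ge> N" "m \<ge> N" "l \<ge> N" for n m l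
      using G_le_d_add_d[OF s[of n] s[of m] s[of l]] near[OF that(1)] near[OF that(2)]
        near[OF that(3)] N d_triangle[OF s[of n] s[of N] s[of m]]
        d_triangle[OF s[of n] s[of N] s[of l]] d_commute[of "s n" "s N"]
      by linarith
    then show ?thesis by blast
  qed
  then show ?thesis using s by (simp add: G_Cauchy_def)
qed

text \<open>\<open>f (g (w n))\<close> stays close to \<open>g (f (w n))\<close>, which tends to
  \<open>g z\<close> by continuity. The factor 3 arises since weak commutation bounds only one order
  of the arguments of \<open>G\<close>.\<close>

lemma weakly_commuting_converges:
  assumes wc: "weakly_commuting X G f g" and cont: "seq_continuous X G g"
    and f: "f \<in> X \<rightarrow> X" and g: "g \<in> X \<rightarrow> X" and w: "range w \<subseteq> X"
    and limf: "G_converges X G (\<lambda>n. f (w n)) z"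
    and limg: "G_converges X G (\<lambda>n. g (w n)) z"
  shows "G_converges X G (\<lambda>n. f (g (w n))) (g z)"
proof -
  have wX: "w n \<in> X" for n using w by auto
  have fX: "f x \<in> X" and gX: "g x \<in> X" if "x \<in> X" for x using f g that by auto
  have z: "z \<in> X" using limf by (simp add: G_converges_iff)
  have lim: "(\<lambda>n. 3 * d (f (w n)) (g (w n)) + d (g (f (w n))) (g z)) \<longlonglongrightarrow> 3 * d z z + 0"
    using limf cont
    by (intro tendsto_intros tendsto_d[OF limf limg]) (auto simp: seq_continuous_def G_converges_iff)
  have bound: "d (f (g (w n))) (g z) \<le> 3 * d (f (w n)) (g (w n)) + d (g (f (w n))) (g z)" for n
  proof -
    have "G (f (g (w n))) (g (f (w n))) (g (f (w n))) \<le> G (f (w n)) (g (w n)) (g (w n))"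
      using wc wX by (simp add: weakly_commuting_def)
    then show ?thesis
      using d_le_3_G[of "f (g (w n))" "g (f (w n))"] G_le_d[of "f (w n)" "g (w n)"]
        d_triangle[of "f (g (w n))" "g (f (w n))" "g z"]
      by (simp add: fX gX wX z)
  qed
  have "(\<lambda>n. d (f (g (w n))) (g z)) \<longlonglongrightarrow> 0"
    by (rule tendsto_sandwich[OF _ _ tendsto_const lim[simplified d_refl[OF z], simplified]])
      (auto simp: bound d_nonneg fX gX wX z)
  then show ?thesis using fX gX wX z by (auto simp: G_converges_iff)
qed

end

theorem theorem2:
  fixes X :: "'a set" and G :: "'a \<Rightarrow> 'a \<Rightarrow> 'a \<Rightarrow> real"
    and A B S T :: "'a \<Rightarrow> 'a" and \<kappa> :: real
  assumes "G_metric_space X G" and "G_complete X G"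
    and "A \<in> X \<rightarrow> X" and "B \<in> X \<rightarrow> X" and "S \<in> X \<rightarrow> X" and "T \<in> X \<rightarrow> X"
    and "0 \<le> \<kappa>" and "\<kappa> < 1 / 2"
    and "\<And>x y. \<lbrakk>x \<in> X; y \<in> X\<rbrakk> \<Longrightarrow>
      G (S x) (T y) (T y) \<le> \<kappa> * (G (S x) (A x) (A x) + G (T y) (B y) (B y))"
    and "\<And>x y. \<lbrakk>x \<in> X; y \<in> X\<rbrakk> \<Longrightarrow>
      G (S x) (S x) (T y) \<le> \<kappa> * (G (S x) (S x) (A x) + G (T y) (T y) (B y))"
    and "T ` X \<subseteq> A ` X" and "S ` X \<subseteq> B ` X"
    and "seq_continuous X G A" and "seq_continuous X G B"
    and "weakly_commuting X G S A" and "weakly_commuting X G T B"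
  shows "\<exists>!z. z \<in> X \<and> A z = z \<and> B z = z \<and> S z = z \<and> T z = z"
proof -
  interpret G_metric_space X G by fact
  have AX: "A x \<in> X" and BX: "B x \<in> X" and SX: "S x \<in> X" and TX: "T x \<in> X" if "x \<in> X" for x
    using assms(3-6) that by auto
  have kannan: "d (S x) (T y) \<le> \<kappa> * (d (S x) (A x) + d (T y) (B y))"
    if "x \<in> X" "y \<in> X" for x y
  proof -
    have "G (T y) (S x) (S x) \<le> \<kappa> * (G (A x) (S x) (S x) + G (B y) (T y) (T y))"
      using assms(10)[OF that] that G_swap[of "S x" "T y"] G_swap[of "S x" "A x"]
        G_swap[of "T y" "B y"]
      by (simp add: AX BX SX TX)
    then show ?thesis using assms(9)[OF that] by (simp add: d_def algebra_simps)
  qed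
  obtain x0 where x0: "x0 \<in> X" using nonempty by blast
  \<comment> \<open>\<open>p\<close> and \<open>q\<close> choose preimages under \<open>A\<close>
    and \<open>B\<close>; below, \<open>u n\<close> and \<open>v n\<close> are the Jungck points of
    index \<open>2 * n\<close> and \<open>2 * n + 1\<close>, and \<open>y\<close> is the sequence of
    their images under \<open>S\<close> and \<open>T\<close>.\<close>
  obtain p where p: "p y \<in> X" "A (p y) = T y" if "y \<in> X" for y
    using assms(11) unfolding image_subset_iff image_iff by metis
  obtain q where q: "q x \<in> X" "B (q x) = S x" if "x \<in> X" for x
    using assms(12) unfolding image_subset_iff image_iff by metis
  define u where "u n = ((p \<circ> q) ^^ n) x0" for n
  define v where "v n = q (u n)" for n
  have uX: "u n \<in> X" for n by (induction n) (auto simp: u_def x0 p q)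
  have vX: "v n \<in> X" for n by (simp add: v_def q uX)
  have Bv: "B (v n) = S (u n)" for n by (simp add: v_def q uX)
  have Au: "A (u (Suc n)) = T (v n)" for n using p(2)[OF vX[of n]] by (simp add: u_def v_def)
  define y where "y n = (if even n then S (u (n div 2)) else T (v (n div 2)))" for n
  have yX: "y n \<in> X" for n by (simp add: y_def SX TX uX vX)
  have "d (y (Suc n)) (y (Suc (Suc n))) \<le> \<kappa> * (d (y n) (y (Suc n)) + d (y (Suc n)) (y (Suc (Suc n))))"
    for n
  proof (cases "even n")
    case True
    then show ?thesis
      using kannan[OF uX[of "Suc (n div 2)"] vX[of "n div 2"]]
      by (simp add: y_def Au Bv d_commute add.commute)
  next
    case False
    then have "Suc n div 2 = Suc (n div 2)" by presburger
    then show ?thesis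
      using False kannan[OF uX[of "Suc (n div 2)"] vX[of "Suc (n div 2)"]]
      by (simp add: y_def Au Bv d_commute add.commute)
  qed
  \<comment> \<open>The new step length occurs on both sides; solving for it gives the ratio, which
    is below 1 exactly because \<open>\<kappa> < 1 / 2\<close>.\<close>
  then have "d (y (Suc n)) (y (Suc (Suc n))) \<le> \<kappa> / (1 - \<kappa>) * d (y n) (y (Suc n))" for n
    using assms(8) by (simp add: field_simps)
  then have "G_Cauchy X G y"
    using assms(7,8) by (intro G_Cauchy_if_geometric[where q = "\<kappa> / (1 - \<kappa>)"] yX) auto
  then obtain z where z: "z \<in> X" and yz: "G_converges X G y z"
    using assms(2) by (auto simp: G_complete_def)
  have Tv: "G_converges X G (\<lambda>n. T (v n)) z"
    using G_converges_subseq[OF yz, of "\<lambda>n. 2 * n + 1"] by (simp add: y_def strict_mono_def)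
  have Su: "G_converges X G (\<lambda>n. S (u n)) z"
    using G_converges_subseq[OF yz, of "\<lambda>n. 2 * n"] by (simp add: y_def strict_mono_def)
  \<comment> \<open>The shift matches \<open>A (u (Suc n)) = T (v n)\<close>, so that the images of
    \<open>u (Suc n)\<close> under \<open>S\<close> and \<open>A\<close> share the limit
    \<open>z\<close>.\<close>
  have Su': "G_converges X G (\<lambda>n. S (u (Suc n))) z"
    using G_converges_subseq[OF Su, of Suc] by (simp add: strict_mono_def)
  have SA: "G_converges X G (\<lambda>n. S (T (v n))) (A z)"
    using weakly_commuting_converges[OF assms(15,13,5,3) _ Su'] Tv uX
    by (simp add: Au image_subset_iff)
  have TB: "G_converges X G (\<lambda>n. T (S (u n))) (B z)"
    using weakly_commuting_converges[OF assms(16,14,6,4) _ Tv] Su vX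
    by (simp add: Bv image_subset_iff)
  have AA: "G_converges X G (\<lambda>n. A (T (v n))) (A z)" and BB: "G_converges X G (\<lambda>n. B (S (u n))) (B z)"
    using assms Tv Su by (auto simp: seq_continuous_def)
  \<comment> \<open>The four sequences are independent, so one side of the Kannan inequality may be
    kept constant at \<open>z\<close> while the other runs along the Jungck sequence.\<close>
  have limit: "d a b \<le> \<kappa> * (d a a' + d b b')"
    if "G_converges X G s a" "G_converges X G s' a'" "G_converges X G t b" "G_converges X G t' b'"
      and "\<And>n. d (s n) (t n) \<le> \<kappa> * (d (s n) (s' n) + d (t n) (t' n))" for s s' t t' a a' b b'
    using that(5)
    by (intro LIMSEQ_le[OF tendsto_d[OF that(1,3)]
          tendsto_mult[OF tendsto_const tendsto_add[OF tendsto_d[OF that(1,2)] tendsto_d[OF that(3,4)]]]])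
      auto
  \<comment> \<open>Kannan at \<open>T (v n)\<close> and \<open>S (u n)\<close>: on the right, both
    distances compare sequences with the same limit and vanish.\<close>
  have "d (A z) (B z) \<le> 0"
    using limit[OF SA AA TB BB] kannan by (simp add: SX TX AX BX uX vX z d_refl)
  then have AB: "A z = B z" using d_le_0_imp_eq AX BX z by blast
  have *: "a = b" if "a \<in> X" "b \<in> X" "d a b \<le> \<kappa> * d a b" for a b
  proof (rule d_le_0_imp_eq[OF that(1,2)])
    have "0 \<le> (\<kappa> - 1) * d a b" using that(3) by (simp add: algebra_simps)
    then show "d a b \<le> 0" using assms(8) by (simp add: zero_le_mult_iff)
  qed
  \<comment> \<open>Kannan at \<open>z\<close> and \<open>S (u n)\<close>. As
    \<open>A z = B z\<close>, the right side is \<open>\<kappa>\<close> times the left, so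
    \<open>*\<close> applies.\<close>
  have "d (S z) (B z) \<le> \<kappa> * (d (S z) (A z) + d (B z) (B z))"
    using limit[OF G_converges_const G_converges_const TB BB] kannan by (simp add: SX AX uX z)
  then have SB: "S z = B z" using * AB by (simp add: SX BX z d_refl)
  have "d (S z) (T z) \<le> \<kappa> * (d (S z) (A z) + d (T z) (B z))"
    using kannan z by blast
  then have ST: "S z = T z" using * AB SB by (simp add: SX TX BX z d_refl d_commute)
  \<comment> \<open>Kannan at \<open>z\<close> and \<open>v n\<close>, where \<open>T (v n)\<close>
    and \<open>B (v n) = S (u n)\<close> both tend to \<open>z\<close>; the right side is 0 since
    \<open>S z = A z\<close>.\<close>
  have "d (S z) z \<le> \<kappa> * (d (S z) (A z) + d z z)"
    using limit[OF G_converges_const G_converges_const Tv Su] kannan[OF z vX] Bv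
    by (simp add: SX AX z)
  then have "S z = z" using AB SB d_le_0_imp_eq by (simp add: SX BX z d_refl)
  then show ?thesis
  proof (intro ex1I[of _ z])
    fix w assume w: "w \<in> X \<and> A w = w \<and> B w = w \<and> S w = w \<and> T w = w"
    then have "d w z \<le> 0"
      using kannan[of w z] z \<open>S z = z\<close> AB SB ST by (simp add: d_refl)
    then show "w = z" using w z d_le_0_imp_eq by blast
  qed (use z AB SB ST in auto)
qed

end
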